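(* Let $f:\mathbb{F}_2^n\to\mathbb{F}_2^n$ be a Boolean monomial system with dependency graph $\mathcal{X}$. Then $f$ is a fixed point system if and only if every strongly connected component of $\mathcal{X}$ either corresponds to a fixed point system or is connected by a walk to a zero in $\mathcal{X}$.
   Context: A Boolean monomial system is a map $f=(f_1,\ldots,f_n):\mathbb{F}_2^n\to\mathbb{F}_2^n$ where each $f_i=\alpha_i x_1^{\varepsilon_{1i}}\cdots x_n^{\varepsilon_{ni}}$ with $\alpha_i,\varepsilon_{ji}\in\{0,1\}$ (all $\varepsilon_{ji}=0$ if $\alpha_i=0$); so each $f_i$ is $0$, $1$, or a product of distinct variables. $f$ is a fixed point system if all limit cycles (directed cycles of the digraph $u\to f(u)$ on $\mathbb{F}_2^n$) are fixed points. The dependency graph $\mathcal{X}$ of $f$ is the digraph with vertex set $\{a_1,\ldots,a_n,\varepsilon\}$, with an edge $a_i\to a_j$ iff $\alpha_i=1$ and $\varepsilon_{ji}=1$ (i.e. $x_j$ divides $f_i$), and an edge $a_i\to\varepsilon$ iff $f_i=0$. The system is completely determined by its dependency graph. A vertex with an edge to $\varepsilon$ is called a zero. A walk is a directed walk (repetitions allowed); every vertex has an empty walk of length $0$ to itself. Two vertices $a,b\neq\varepsilon$ are strongly connected if there are walks $a\to b$ and $b\to a$; the equivalence classes of this relation on $\{a_1,\dots,a_n\}$ are the strongly connected components. The system corresponding to a component $C$ is the Boolean monomial system on $\mathbb{F}_2^C$ whose dependency graph is the subgraph of $\mathcal{X}$ induced on $C\cup\{\varepsilon\}$: its coordinate at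 $a_i\in C$ is $0$ if $f_i=0$, and otherwise is the product of those $x_j$ dividing $f_i$ with $a_j\in C$ (the empty product being $1$). *)

theory Defs
  imports
    "HOL-Library.Z2"
    "HOL-Library.FuncSet"
    "Graph_Theory.Graph_Theory"
begin

text \<open>
  Systems are indexed by an arbitrary finite set \<open>V\<close> of variable indices, so that the same notions
  apply to \<open>f\<close> itself (\<open>V = {1..n}\<close>) and to the systems on the components of its dependency graph.
  Points of $\mathbb{F}_2^V$ are functions that are \<open>undefined\<close> outside \<open>V\<close>.
\<close>

definition cube :: "'v set \<Rightarrow> ('v \<Rightarrow> bit) set" where
  "cube V = (\<Pi>\<^sub>E i\<in>V. UNIV)"

text \<open>The exponent of the variable \<open>j\<close> in the coordinate \<open>i\<close> is \<open>\<epsilon> j i\<close>.\<close>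

definition monomial_data :: "'v set \<Rightarrow> ('v \<Rightarrow> bit) \<Rightarrow> ('v \<Rightarrow> 'v \<Rightarrow> nat) \<Rightarrow> bool" where
  "monomial_data V \<alpha> \<epsilon> \<longleftrightarrow>
     (\<forall>i\<in>V. \<forall>j\<in>V. \<epsilon> j i \<in> {0, 1}) \<and>
     (\<forall>i\<in>V. \<alpha> i = 0 \<longrightarrow> (\<forall>j\<in>V. \<epsilon> j i = 0))"

definition monomial_map ::
  "'v set \<Rightarrow> ('v \<Rightarrow> bit) \<Rightarrow> ('v \<Rightarrow> 'v \<Rightarrow> nat) \<Rightarrow> ('v \<Rightarrow> bit) \<Rightarrow> ('v \<Rightarrow> bit)" where
  "monomial_map V \<alpha> \<epsilon> x = (\<lambda>i\<in>V. \<alpha> i * (\<Prod>j\<in>V. x j ^ \<epsilon> j i))"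

definition boolean_monomial_system ::
  "'v set \<Rightarrow> ('v \<Rightarrow> bit) \<Rightarrow> ('v \<Rightarrow> 'v \<Rightarrow> nat) \<Rightarrow> (('v \<Rightarrow> bit) \<Rightarrow> ('v \<Rightarrow> bit)) \<Rightarrow> bool" where
  "boolean_monomial_system V \<alpha> \<epsilon> f \<longleftrightarrow>
     finite V \<and> monomial_data V \<alpha> \<epsilon> \<and> (\<forall>x\<in>cube V. f x = monomial_map V \<alpha> \<epsilon> x)"

definition state_graph ::
  "'v set \<Rightarrow> (('v \<Rightarrow> bit) \<Rightarrow> ('v \<Rightarrow> bit)) \<Rightarrow> ('v \<Rightarrow> bit, ('v \<Rightarrow> bit) \<times> ('v \<Rightarrow> bit)) pre_digraph" where
  "state_graph V f =
     \<lparr>verts = cube V, arcs = {(u, f u) | u. u \<in> cube V}, tail = fst, head = snd\<rparr>"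

definition fixed_point_system :: "'v set \<Rightarrow> (('v \<Rightarrow> bit) \<Rightarrow> ('v \<Rightarrow> bit)) \<Rightarrow> bool" where
  "fixed_point_system V f \<longleftrightarrow>
     (\<forall>p. pre_digraph.cycle (state_graph V f) p \<longrightarrow> (\<exists>u\<in>cube V. f u = u \<and> p = [(u, u)]))"

datatype 'v vertex = Var 'v | Eps

definition dependency_graph ::
  "'v set \<Rightarrow> ('v \<Rightarrow> bit) \<Rightarrow> ('v \<Rightarrow> 'v \<Rightarrow> nat) \<Rightarrow> ('v vertex, 'v vertex \<times> 'v vertex) pre_digraph" where
  "dependency_graph V \<alpha> \<epsilon> =
     \<lparr>verts = insert Eps (Var ` V),
      arcs = {(Var i, Var j) | i j. i \<in> V \<and> j \<in> V \<and> \<alpha> i = 1 \<and> \<epsilon> j i = 1} \<union>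
             {(Var i, Eps) | i. i \<in> V \<and> \<alpha> i = 0},
      tail = fst, head = snd\<rparr>"

definition has_walk :: "('a, 'b) pre_digraph \<Rightarrow> 'a \<Rightarrow> 'a \<Rightarrow> bool" where
  "has_walk G a b \<longleftrightarrow> (\<exists>p. pre_digraph.awalk G a p b)"

definition is_zero :: "('v vertex, 'v vertex \<times> 'v vertex) pre_digraph \<Rightarrow> 'v vertex \<Rightarrow> bool" where
  "is_zero G a \<longleftrightarrow> a \<in> verts G \<and> (a, Eps) \<in> arcs G"

text \<open>
  The vertex \<open>Eps\<close> belongs to no component, so this is not \<open>sccs_verts\<close> of the
  dependency graph; components are given by the indices of their vertices.
\<close>

definition components :: "'v set \<Rightarrow> ('v vertex, 'v vertex \<times> 'v vertex) pre_digraph \<Rightarrow> 'v set set" where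
  "components V G =
     V // {(i, j). i \<in> V \<and> j \<in> V \<and> has_walk G (Var i) (Var j) \<and> has_walk G (Var j) (Var i)}"

definition connected_to_zero ::
  "('v vertex, 'v vertex \<times> 'v vertex) pre_digraph \<Rightarrow> 'v set \<Rightarrow> bool" where
  "connected_to_zero G C \<longleftrightarrow> (\<exists>i\<in>C. \<exists>z. is_zero G z \<and> has_walk G (Var i) z)"

text \<open>
  The system corresponding to a component \<open>C\<close> is \<open>monomial_map C \<alpha> \<epsilon>\<close>, with the coefficients
  and exponents of \<open>f\<close> but all indices confined to \<open>C\<close>.
\<close>

lemma boolean_monomial_system_component:
  assumes "boolean_monomial_system V \<alpha> \<epsilon> f" and "C \<subseteq> V"
  shows "boolean_monomial_system C \<alpha> \<epsilon> (monomial_map C \<alpha> \<epsilon>)"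
  using assms finite_subset[of C V]
  unfolding boolean_monomial_system_def monomial_data_def by blast

lemma dependency_graph_component:
  assumes "C \<subseteq> V"
  shows "dependency_graph C \<alpha> \<epsilon> = dependency_graph V \<alpha> \<epsilon> \<restriction> insert Eps (Var ` C)"
  using assms unfolding dependency_graph_def induce_subgraph_def by auto

lemma monomial_map_component:
  assumes "monomial_data V \<alpha> \<epsilon>" and "finite V" and "C \<subseteq> V" and "i \<in> C"
  shows "monomial_map C \<alpha> \<epsilon> x i = (if \<alpha> i = 0 then 0 else \<Prod>j | j \<in> C \<and> \<epsilon> j i = 1. x j)"
proof -
  have "(\<Prod>j\<in>C. x j ^ \<epsilon> j i) = (\<Prod>j\<in>C. if \<epsilon> j i = 1 then x j else 1)"
    using assms unfolding monomial_data_def by (intro prod.cong) auto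
  also have "\<dots> = (\<Prod>j | j \<in> C \<and> \<epsilon> j i = 1. x j)"
    using finite_subset[OF assms(3,2)] by (rule prod.inter_filter[symmetric])
  finally show ?thesis
    using assms(4) by (cases "\<alpha> i") (auto simp: monomial_map_def)
qed

end

theory Submission
  imports Defs
begin

text \<open>
  \<open>f\<close> is a fixed point system iff each of its periodic points is fixed. A coordinate from which a zero
  is reachable vanishes at every periodic point. Suppose that all coordinates reachable from a
  component \<open>C\<close> but outside it are constant along a periodic orbit. If one of them is \<open>0\<close> and divides
  a coordinate of \<open>C\<close>, then by strong connectedness the orbit vanishes on \<open>C\<close>; otherwise those
  dividing a coordinate of \<open>C\<close> are all \<open>1\<close>, and the orbit restricted to \<open>C\<close> is an orbit of
  the system of \<open>C\<close>.
  Well-founded induction along reachability then gives one direction. Conversely, let \<open>C\<close> reach no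
  zero. A periodic point of its system, extended by \<open>1\<close> to the coordinates reachable from
  \<open>C\<close>, keeps evolving by the system of \<open>C\<close>; its orbit under \<open>f\<close> is eventually periodic,
  hence eventually fixed.
\<close>

section \<open>Limit cycles and periodic points\<close>

text \<open>\<open>cycle\<close> asks the tail of the vertex list to be distinct; for a compatible
  arc list that tail is the list of heads.\<close>

lemma awalk_verts_conv_head:
  "pre_digraph.cas G u p v \<Longrightarrow> pre_digraph.awalk_verts G u p = u # map (head G) p"
  by (induction p arbitrary: u)
    (auto simp: pre_digraph.awalk_verts.simps pre_digraph.cas.simps)

text \<open>Each state \<open>u\<close> has the single outgoing arc \<open>(u, f u)\<close>, so a
  walk is determined by its start and its length.\<close>

lemma awalk_state_graph_iff:
  assumes closed: "\<And>x. x \<in> cube V \<Longrightarrow> f x \<in> cube V"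
  shows "pre_digraph.awalk (state_graph V f) u p v \<longleftrightarrow>
    u \<in> cube V \<and> v = (f ^^ length p) u \<and>
    p = map (\<lambda>k. ((f ^^ k) u, (f ^^ Suc k) u)) [0..<length p]"
proof (induction p arbitrary: u)
  case Nil
  then show ?case
    by (auto simp: pre_digraph.awalk_def pre_digraph.cas.simps state_graph_def)
next
  case (Cons e p)
  have "pre_digraph.awalk (state_graph V f) u (e # p) v \<longleftrightarrow>
      u \<in> cube V \<and> e = (u, f u) \<and> pre_digraph.awalk (state_graph V f) (f u) p v"
    using closed by (auto simp: pre_digraph.awalk_def pre_digraph.cas.simps state_graph_def)
  then show ?case
    using closed by (auto simp: Cons.IH map_upt_Suc funpow_swap1 simp del: upt_Suc)
qed

text \<open>The iterates run from 1 to \<open>m\<close>, being the heads of the arcs of the closed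
  walk. A repetition among them would close the orbit before time \<open>m\<close>.\<close>

lemma distinct_orbit_minimal_period:
  fixes f :: "'a \<Rightarrow> 'a"
  assumes "m > 0" and "(f ^^ m) u = u" and min: "\<And>k. 0 < k \<Longrightarrow> k < m \<Longrightarrow> (f ^^ k) u \<noteq> u"
  shows "distinct (map (\<lambda>k. (f ^^ Suc k) u) [0..<m])"
proof -
  have False if "i < j" "j < m" "(f ^^ Suc i) u = (f ^^ Suc j) u" for i j
  proof -
    \<comment> \<open>Another \<open>m - Suc j\<close> steps turn time \<open>Suc j\<close> into the
      full period \<open>m\<close>, and time \<open>Suc i\<close> into a shorter one.\<close>
    have "m - (j - i) = m - Suc j + Suc i" "m = m - Suc j + Suc j"
      using that by simp_all
    then have "(f ^^ (m - (j - i))) u = (f ^^ (m - Suc j)) ((f ^^ Suc i) u)"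
      and "(f ^^ m) u = (f ^^ (m - Suc j)) ((f ^^ Suc j) u)"
      by (metis funpow_add comp_apply)+
    then have "(f ^^ (m - (j - i))) u = u"
      using that(3) assms(2) by (simp only:)
    moreover have "0 < m - (j - i)" "m - (j - i) < m"
      using that(1,2) by linarith+
    ultimately show False
      using min by blast
  qed
  then show ?thesis
    unfolding distinct_map by (auto simp: inj_on_def) (metis linorder_neqE_nat)
qed

lemma fixed_point_system_iff:
  assumes closed: "\<And>x. x \<in> cube V \<Longrightarrow> f x \<in> cube V"
  shows "fixed_point_system V f \<longleftrightarrow>
    (\<forall>x\<in>cube V. \<forall>m>0. (f ^^ m) x = x \<longrightarrow> f x = x)"
proof
  assume fps: "fixed_point_system V f"
  show "\<forall>x\<in>cube V. \<forall>m>0. (f ^^ m) x = x \<longrightarrow> f x = x"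
  proof (intro ballI allI impI)
    fix x and m :: nat
    assume x: "x \<in> cube V" and m: "m > 0" "(f ^^ m) x = x"
    \<comment> \<open>The walk over an arbitrary period may repeat vertices; over the least period
      it is a cycle.\<close>
    define l where "l = (LEAST l. l > 0 \<and> (f ^^ l) x = x)"
    have l: "l > 0 \<and> (f ^^ l) x = x"
      unfolding l_def by (rule LeastI) (use m in auto)
    have min: "(f ^^ k) x \<noteq> x" if "0 < k" "k < l" for k
      using not_less_Least[of k "\<lambda>l. l > 0 \<and> (f ^^ l) x = x"] that by (auto simp: l_def)
    define p where "p = map (\<lambda>k. ((f ^^ k) x, (f ^^ Suc k) x)) [0..<l]"
    have "pre_digraph.awalk (state_graph V f) x p x"
      using x l by (simp add: awalk_state_graph_iff[OF closed] p_def)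
    moreover have "map (head (state_graph V f)) p = map (\<lambda>k. (f ^^ Suc k) x) [0..<l]" "p \<noteq> []"
      using l by (simp_all add: p_def state_graph_def)
    ultimately have "pre_digraph.cycle (state_graph V f) p"
      using distinct_orbit_minimal_period[of l f x] l min
      unfolding pre_digraph.cycle_def
      by (auto simp: pre_digraph.awalk_def awalk_verts_conv_head intro!: exI[of _ x])
    then obtain u where "f u = u" "p = [(u, u)]"
      using fps unfolding fixed_point_system_def by blast
    \<comment> \<open>The first arc identifies the vertex \<open>u\<close> of the loop with
      \<open>x\<close>.\<close>
    moreover from this have "hd p = (x, f x)"
      using l by (simp add: p_def upt_conv_Cons)
    ultimately show "f x = x"
      by simp
  qed
next
  assume *: "\<forall>x\<in>cube V. \<forall>m>0. (f ^^ m) x = x \<longrightarrow> f x = x"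
  show "fixed_point_system V f"
    unfolding fixed_point_system_def
  proof (intro allI impI)
    fix p
    assume "pre_digraph.cycle (state_graph V f) p"
    then obtain u where walk: "pre_digraph.awalk (state_graph V f) u p u"
      and dist: "distinct (tl (pre_digraph.awalk_verts (state_graph V f) u p))" and "p \<noteq> []"
      unfolding pre_digraph.cycle_def by blast
    have orbit: "u \<in> cube V \<and> u = (f ^^ length p) u \<and>
        p = map (\<lambda>k. ((f ^^ k) u, (f ^^ Suc k) u)) [0..<length p]"
      by (rule iffD1[OF awalk_state_graph_iff]) (fact closed walk)+
    note u = conjunct1[OF orbit] conjunct1[OF conjunct2[OF orbit], symmetric]
      and p = conjunct2[OF conjunct2[OF orbit]]
    have fu: "f u = u"
      using *[rule_format, OF u(1), of "length p"] u(2) \<open>p \<noteq> []\<close> by simp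
    then have "(f ^^ k) u = u" for k
      by (induction k) auto
    then have p': "p = replicate (length p) (u, u)"
      by (intro trans[OF p]) (simp only: map_replicate_const length_upt diff_zero)
    have "map (head (state_graph V f)) p = replicate (length p) u"
      using arg_cong[OF p', of "map (head (state_graph V f))"] by (simp add: state_graph_def)
    then have "distinct (replicate (length p) u)"
      using dist walk awalk_verts_conv_head[of "state_graph V f" u p u]
      by (simp add: pre_digraph.awalk_def)
    \<comment> \<open>All heads coincide, so distinctness leaves a single arc.\<close>
    with \<open>p \<noteq> []\<close> have "length p = 1"
      by (cases "length p" rule: nat.exhaust; cases "length p - 1") auto
    then have "p = [(u, u)]"
      using p' by (metis One_nat_def replicate_0 replicate_Suc)
    then show "\<exists>u\<in>cube V. f u = u \<and> p = [(u, u)]"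
      using u fu by blast
  qed
qed

text \<open>A system is tied to its monomial map only on the cube, and the state graph sees no other
  points.\<close>

lemma fixed_point_system_cong:
  assumes "\<And>x. x \<in> cube V \<Longrightarrow> f x = g x"
  shows "fixed_point_system V f \<longleftrightarrow> fixed_point_system V g"
proof -
  have "state_graph V f = state_graph V g"
    unfolding state_graph_def using assms by auto
  then show ?thesis
    unfolding fixed_point_system_def using assms by auto
qed

section \<open>Dependencies between coordinates\<close>

text \<open>The dependency graph without \<open>Eps\<close>, taken as a relation so that walks
  become its reflexive transitive closure.\<close>

definition depends :: "'v set \<Rightarrow> ('v \<Rightarrow> bit) \<Rightarrow> ('v \<Rightarrow> 'v \<Rightarrow> nat) \<Rightarrow> 'v rel" where
  "depends V \<alpha> \<epsilon> = {(i, j). i \<in> V \<and> j \<in> V \<and> \<alpha> i = 1 \<and> \<epsilon> j i = 1}"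

lemma dependsD: "(i, j) \<in> depends V \<alpha> \<epsilon> \<Longrightarrow> i \<in> V \<and> j \<in> V"
  by (simp add: depends_def)

lemma rtrancl_depends_in: "(i, j) \<in> (depends V \<alpha> \<epsilon>)\<^sup>* \<Longrightarrow> i \<in> V \<Longrightarrow> j \<in> V"
  by (induction rule: rtrancl_induct) (auto dest: dependsD)

text \<open>No arc leaves \<open>Eps\<close>, so walks between variables avoid it. The closure is
  reflexive on all indices, whereas an empty walk has to start at a vertex; hence the conjunct
  \<open>i \<in> V\<close>.\<close>

lemma has_walk_dependency_graph_iff:
  "has_walk (dependency_graph V \<alpha> \<epsilon>) (Var i) (Var j) \<longleftrightarrow>
    i \<in> V \<and> (i, j) \<in> (depends V \<alpha> \<epsilon>)\<^sup>*"
proof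
  let ?G = "dependency_graph V \<alpha> \<epsilon>"
  have "i \<in> V \<and> (i, j) \<in> (depends V \<alpha> \<epsilon>)\<^sup>*"
    if "Var i \<in> verts ?G" "set p \<subseteq> arcs ?G" "pre_digraph.cas ?G (Var i) p (Var j)" for p
    using that
  proof (induction p arbitrary: i)
    case Nil
    then show ?case
      by (auto simp: pre_digraph.cas.simps dependency_graph_def)
  next
    case (Cons e p)
    have e: "e \<in> arcs ?G" "fst e = Var i" and p: "pre_digraph.cas ?G (snd e) p (Var j)"
      using Cons.prems by (auto simp: pre_digraph.cas.simps dependency_graph_def)
    show ?case
    proof (cases "snd e")
      case (Var k)
      then have "(i, k) \<in> depends V \<alpha> \<epsilon>"
        using e by (auto simp: dependency_graph_def depends_def)
      then show ?thesis
        using Cons.IH[of k] Cons.prems p Var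
        by (auto simp: dependency_graph_def depends_def intro: converse_rtrancl_into_rtrancl)
    next
      case Eps
      show ?thesis
      proof (cases p)
        case Nil
        then show ?thesis
          using p Eps by (simp add: pre_digraph.cas.simps)
      next
        case (Cons e' p')
        then have "fst e' = Eps" "e' \<in> arcs ?G"
          using p Eps Cons.prems by (auto simp: pre_digraph.cas.simps dependency_graph_def)
        then show ?thesis
          by (auto simp: dependency_graph_def)
      qed
    qed
  qed
  then show "i \<in> V \<and> (i, j) \<in> (depends V \<alpha> \<epsilon>)\<^sup>*" if "has_walk ?G (Var i) (Var j)"
    using that unfolding has_walk_def pre_digraph.awalk_def by blast
  show "has_walk ?G (Var i) (Var j)" if ij: "i \<in> V \<and> (i, j) \<in> (depends V \<alpha> \<epsilon>)\<^sup>*"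
  proof -
    from ij have "(i, j) \<in> (depends V \<alpha> \<epsilon>)\<^sup>*"
      by simp
    then have "i \<in> V \<Longrightarrow> \<exists>p. pre_digraph.awalk ?G (Var i) p (Var j)"
    proof (induction rule: converse_rtrancl_induct)
      case base
      then show ?case
        by (intro exI[of _ "[]"])
          (auto simp: pre_digraph.awalk_def pre_digraph.cas.simps dependency_graph_def)
    next
      case (step i k)
      then obtain p where "pre_digraph.awalk ?G (Var k) p (Var j)"
        by (auto dest: dependsD)
      then have "pre_digraph.awalk ?G (Var i) ((Var i, Var k) # p) (Var j)"
        using step by (auto simp: pre_digraph.awalk_def pre_digraph.cas.simps
            dependency_graph_def depends_def)
      then show ?case ..
    qed
    then show ?thesis
      using ij by (simp add: has_walk_def)
  qed
qed

lemma connected_to_zero_iff: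
  "connected_to_zero (dependency_graph V \<alpha> \<epsilon>) C \<longleftrightarrow>
    (\<exists>i\<in>C. \<exists>j\<in>V. i \<in> V \<and> \<alpha> j = 0 \<and> (i, j) \<in> (depends V \<alpha> \<epsilon>)\<^sup>*)"
proof -
  have "is_zero (dependency_graph V \<alpha> \<epsilon>) z \<longleftrightarrow> (\<exists>j\<in>V. z = Var j \<and> \<alpha> j = 0)" for z
    by (auto simp: is_zero_def dependency_graph_def)
  then show ?thesis
    using has_walk_dependency_graph_iff[of V \<alpha> \<epsilon>] unfolding connected_to_zero_def by metis
qed

lemma components_eq:
  "components V (dependency_graph V \<alpha> \<epsilon>) =
    (\<lambda>i. {j. (i, j) \<in> (depends V \<alpha> \<epsilon>)\<^sup>* \<and> (j, i) \<in> (depends V \<alpha> \<epsilon>)\<^sup>*}) ` V"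
proof -
  let ?R = "{(i, j). i \<in> V \<and> j \<in> V \<and> has_walk (dependency_graph V \<alpha> \<epsilon>) (Var i) (Var j) \<and>
    has_walk (dependency_graph V \<alpha> \<epsilon>) (Var j) (Var i)}"
  have "?R `` {i} = {j. (i, j) \<in> (depends V \<alpha> \<epsilon>)\<^sup>* \<and> (j, i) \<in> (depends V \<alpha> \<epsilon>)\<^sup>*}"
    if "i \<in> V" for i
    using that by (auto simp: has_walk_dependency_graph_iff intro: rtrancl_depends_in)
  then show ?thesis
    unfolding components_def quotient_def by auto
qed

section \<open>Orbits of monomial systems\<close>

lemma monomial_map_in_cube: "monomial_map V \<alpha> \<epsilon> x \<in> cube V"
  by (simp add: monomial_map_def cube_def)

lemma funpow_monomial_map_in_cube: "x \<in> cube V \<Longrightarrow> (monomial_map V \<alpha> \<epsilon> ^^ k) x \<in> cube V"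
  by (cases k) (auto simp: monomial_map_in_cube)

lemma restrict_in_cube: "restrict x C \<in> cube C"
  by (simp add: cube_def)

text \<open>A product of bits is 1 exactly when all its factors are. Phrased with
  \<open>depends V\<close> and \<open>C \<subseteq> V\<close>, this serves both the full system and
  its components.\<close>

lemma monomial_map_eq_1_iff:
  assumes "monomial_data V \<alpha> \<epsilon>" "finite V" "C \<subseteq> V" "i \<in> C"
  shows "monomial_map C \<alpha> \<epsilon> x i = 1 \<longleftrightarrow>
    \<alpha> i = 1 \<and> (\<forall>j\<in>C. (i, j) \<in> depends V \<alpha> \<epsilon> \<longrightarrow> x j = 1)"
proof -
  have fin: "finite {j. j \<in> C \<and> \<epsilon> j i = 1}"
    using finite_subset[OF assms(3,2)] by simp
  have "(\<Prod>j\<in>A. x j) = 1 \<longleftrightarrow> (\<forall>j\<in>A. x j = 1)" if "finite A" for A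
    using that by (induction A rule: finite_induct) auto
  from this[OF fin] show ?thesis
    using assms(3,4) by (auto simp: monomial_map_component[OF assms] depends_def)
qed

text \<open>Factors from outside \<open>C\<close> are 1 and drop out of the products, so one step
  commutes with restriction to \<open>C\<close>.\<close>

lemma restrict_monomial_map:
  assumes "monomial_data V \<alpha> \<epsilon>" "finite V" "C \<subseteq> V"
    and ext: "\<And>i j. i \<in> C \<Longrightarrow> j \<notin> C \<Longrightarrow> (i, j) \<in> depends V \<alpha> \<epsilon> \<Longrightarrow> x j = 1"
  shows "restrict (monomial_map V \<alpha> \<epsilon> x) C = monomial_map C \<alpha> \<epsilon> (restrict x C)"
proof
  fix i
  show "restrict (monomial_map V \<alpha> \<epsilon> x) C i = monomial_map C \<alpha> \<epsilon> (restrict x C) i"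
  proof (cases "i \<in> C")
    case True
    then have "monomial_map V \<alpha> \<epsilon> x i = 1 \<longleftrightarrow> monomial_map C \<alpha> \<epsilon> (restrict x C) i = 1"
      using assms(3) ext monomial_map_eq_1_iff[OF assms(1,2), of V i x]
        monomial_map_eq_1_iff[OF assms(1-3), of i "restrict x C"]
      by (auto dest: dependsD)
    then have "monomial_map V \<alpha> \<epsilon> x i = monomial_map C \<alpha> \<epsilon> (restrict x C) i"
      by (cases "monomial_map V \<alpha> \<epsilon> x i"; cases "monomial_map C \<alpha> \<epsilon> (restrict x C) i") auto
    then show ?thesis
      using True by simp
  qed (simp add: monomial_map_def)
qed

text \<open>A zero factor annihilates, one step later, each monomial that it divides. Followed
  backwards along the path, this reaches \<open>i\<close> at all positive times.\<close>

lemma periodic_zero_propagates: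
  assumes "monomial_data V \<alpha> \<epsilon>" "finite V"
    and per: "m > 0" "(monomial_map V \<alpha> \<epsilon> ^^ m) x = x"
    and "(i, j) \<in> (depends V \<alpha> \<epsilon>)\<^sup>*" "\<And>k. (monomial_map V \<alpha> \<epsilon> ^^ k) x j = 0"
  shows "(monomial_map V \<alpha> \<epsilon> ^^ k) x i = 0"
  using assms(5)
proof (induction arbitrary: k rule: converse_rtrancl_induct)
  case base
  then show ?case
    using assms by simp
next
  case (step i l)
  have Suc: "(monomial_map V \<alpha> \<epsilon> ^^ Suc k) x i = 0" for k
    using monomial_map_eq_1_iff[OF assms(1,2), of V i "(monomial_map V \<alpha> \<epsilon> ^^ k) x"]
      step.hyps(1) step.IH[of k] dependsD[OF step.hyps(1)] by auto
  show ?case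
  proof (cases k)
    \<comment> \<open>Periodicity gives time 0 the state of the positive time
      \<open>m\<close>.\<close>
    case 0
    then show ?thesis
      using Suc[of "m - 1"] per by simp
  qed (use Suc in simp)
qed

text \<open>A zero coefficient makes coordinate \<open>j\<close> vanish after every step, and by
  periodicity also at time 0.\<close>

lemma periodic_zero:
  assumes "monomial_data V \<alpha> \<epsilon>" "finite V"
    and per: "m > 0" "(monomial_map V \<alpha> \<epsilon> ^^ m) x = x"
    and "(i, j) \<in> (depends V \<alpha> \<epsilon>)\<^sup>*" "j \<in> V" "\<alpha> j = 0"
  shows "(monomial_map V \<alpha> \<epsilon> ^^ k) x i = 0"
proof (rule periodic_zero_propagates[OF assms(1-5)])
  fix k
  have Suc: "(monomial_map V \<alpha> \<epsilon> ^^ Suc k) x j = 0" for k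
    using assms by (simp add: monomial_map_def)
  then show "(monomial_map V \<alpha> \<epsilon> ^^ k) x j = 0"
    using Suc[of "m - 1"] per by (cases k) simp_all
qed

section \<open>Sufficiency of the condition on components\<close>

lemma fixed_point_system_if_components:
  assumes data: "monomial_data V \<alpha> \<epsilon>" and fin: "finite V"
    and comp: "\<forall>C\<in>components V (dependency_graph V \<alpha> \<epsilon>).
      fixed_point_system C (monomial_map C \<alpha> \<epsilon>) \<or>
      connected_to_zero (dependency_graph V \<alpha> \<epsilon>) C"
  shows "fixed_point_system V (monomial_map V \<alpha> \<epsilon>)"
proof -
  let ?F = "monomial_map V \<alpha> \<epsilon>" and ?E = "(depends V \<alpha> \<epsilon>)\<^sup>*"
  have const: "(?F ^^ k) x i = x i"
    if x: "x \<in> cube V" "m > 0" "(?F ^^ m) x = x" and "i \<in> V" for x m i k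
    using \<open>i \<in> V\<close>
  \<comment> \<open>The measure counts the indices reachable from \<open>i\<close>; it drops on
    leaving the component of \<open>i\<close>.\<close>
  proof (induction "card {j. (i, j) \<in> ?E}" arbitrary: i k rule: less_induct)
    case less
    define C where "C = {j. (i, j) \<in> ?E \<and> (j, i) \<in> ?E}"
    have C: "C \<in> components V (dependency_graph V \<alpha> \<epsilon>)"
      using less.prems by (auto simp: components_eq C_def)
    have CV: "C \<subseteq> V" "i \<in> C"
      using less.prems by (auto simp: C_def intro: rtrancl_depends_in)
    have zero: ?case if "\<And>k. (?F ^^ k) x i = 0"
      using that[of k] that[of 0] by simp
    have IH: "(?F ^^ k) x b = x b"
      if ab: "a \<in> C" "b \<notin> C" "(a, b) \<in> depends V \<alpha> \<epsilon>" for a b k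
    proof (rule less.hyps)
      show "b \<in> V"
        using ab by (auto dest: dependsD)
      have ib: "(i, b) \<in> ?E"
        using ab by (auto simp: C_def intro: rtrancl_into_rtrancl)
      have "finite {j. (i, j) \<in> ?E}"
        using less.prems fin by (auto intro: finite_subset[of _ V] rtrancl_depends_in)
      \<comment> \<open>The index \<open>i\<close> is missing on the left: otherwise
        \<open>b\<close> would be strongly connected to \<open>i\<close> and lie in
        \<open>C\<close>.\<close>
      moreover have "{j. (b, j) \<in> ?E} \<subset> {j. (i, j) \<in> ?E}"
        using ib ab by (auto simp: C_def)
      ultimately show "card {j. (b, j) \<in> ?E} < card {j. (i, j) \<in> ?E}"
        by (rule psubset_card_mono)
    qed
    show ?case
    proof (cases "connected_to_zero (dependency_graph V \<alpha> \<epsilon>) C")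
      case True
      then obtain a j where "a \<in> C" "j \<in> V" "\<alpha> j = 0" "(a, j) \<in> ?E"
        by (auto simp: connected_to_zero_iff)
      then have "(i, j) \<in> ?E"
        by (auto simp: C_def)
      then show ?thesis
        using periodic_zero[OF data fin x(2,3)] \<open>j \<in> V\<close> \<open>\<alpha> j = 0\<close> zero by blast
    next
      case False
      then have fps: "fixed_point_system C (monomial_map C \<alpha> \<epsilon>)"
        using comp C by blast
      show ?thesis
      \<comment> \<open>By \<open>IH\<close> the factors from outside \<open>C\<close> are constant
        in time: either one of them is 0 forever, or all are 1 forever.\<close>
      proof (cases "\<exists>a b. a \<in> C \<and> b \<notin> C \<and> (a, b) \<in> depends V \<alpha> \<epsilon> \<and> x b = 0")
        case True
        then obtain a b where ab: "a \<in> C" "b \<notin> C" "(a, b) \<in> depends V \<alpha> \<epsilon>" "x b = 0"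
          by blast
        then have "(i, b) \<in> ?E"
          by (auto simp: C_def intro: rtrancl_into_rtrancl)
        moreover have "(?F ^^ k) x b = 0" for k
          using IH[OF ab(1-3)] ab(4) by (rule trans)
        ultimately have "(?F ^^ k) x i = 0" for k
          by (rule periodic_zero_propagates[OF data fin x(2,3)])
        then show ?thesis
          by (rule zero)
      next
        case False
        have one: "(?F ^^ k) x b = 1"
          if "a \<in> C" "b \<notin> C" "(a, b) \<in> depends V \<alpha> \<epsilon>" for a b k
        proof -
          have "x b \<noteq> 0"
            using False that by blast
          then show ?thesis
            unfolding IH[OF that] by simp
        qed
        let ?G = "monomial_map C \<alpha> \<epsilon>" and ?y = "restrict x C"
        have orbit: "restrict ((?F ^^ k) x) C = (?G ^^ k) ?y" for k
        proof (induction k)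
          case (Suc k)
          have "restrict (?F ((?F ^^ k) x)) C = ?G (restrict ((?F ^^ k) x) C)"
            by (rule restrict_monomial_map[OF data fin CV(1)]) (rule one)
          also have "\<dots> = ?G ((?G ^^ k) ?y)"
            by (simp only: Suc)
          finally show ?case
            by (simp only: funpow.simps comp_apply)
        qed simp
        \<comment> \<open>The restricted orbit inherits the period \<open>m\<close>, and the system
          on \<open>C\<close> has only fixed periodic points.\<close>
        have "(?G ^^ m) ?y = ?y"
          using orbit[of m] unfolding x(3) by (rule sym)
        then have "?G ?y = ?y"
          using iffD1[OF fixed_point_system_iff[OF monomial_map_in_cube] fps, rule_format]
            restrict_in_cube x(2) by metis
        then have "(?G ^^ k) ?y = ?y"
          by (induction k) auto
        then have "restrict ((?F ^^ k) x) C i = ?y i"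
          by (simp only: orbit)
        then show ?thesis
          using CV(2) by simp
      qed
    qed
  qed
  have "?F x = x" if x: "x \<in> cube V" "m > 0" "(?F ^^ m) x = x" for x m
  proof (rule PiE_ext)
    show "?F x \<in> (\<Pi>\<^sub>E i\<in>V. UNIV)" "x \<in> (\<Pi>\<^sub>E i\<in>V. UNIV)"
      using x(1) monomial_map_in_cube[of V \<alpha> \<epsilon> x] by (simp_all only: cube_def)
    show "?F x i = x i" if "i \<in> V" for i
      using const[OF x that, of 1] by simp
  qed
  then show ?thesis
    unfolding fixed_point_system_iff[of V ?F, OF monomial_map_in_cube] by blast
qed

section \<open>Necessity of the condition on components\<close>

text \<open>By the pigeonhole principle the orbit takes some value twice; \<open>p\<close> is the
  earlier of the two times and \<open>q\<close> their difference.\<close>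

lemma eventually_periodic:
  fixes F :: "'a \<Rightarrow> 'a"
  assumes "finite A" "x \<in> A" "\<And>z. z \<in> A \<Longrightarrow> F z \<in> A"
  obtains p q :: nat where "q > 0" "(F ^^ q) ((F ^^ p) x) = (F ^^ p) x"
proof -
  have "(F ^^ k) x \<in> A" for k
    by (induction k) (use assms in auto)
  then have "\<not> inj (\<lambda>k. (F ^^ k) x)"
    using \<open>finite A\<close> finite_subset[of "range (\<lambda>k. (F ^^ k) x)" A]
    by (auto dest: finite_imageD)
  then obtain p r where "p < r" "(F ^^ p) x = (F ^^ r) x"
    by (auto simp: inj_def) (metis linorder_neqE_nat)
  moreover from this have "(F ^^ (r - p)) ((F ^^ p) x) = (F ^^ r) x"
    by (metis comp_apply funpow_add le_add_diff_inverse2 less_imp_le_nat)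
  ultimately show ?thesis
    using that[of "r - p" p] by simp
qed

lemma fixed_point_system_component:
  assumes data: "monomial_data V \<alpha> \<epsilon>" and fin: "finite V"
    and fps: "fixed_point_system V (monomial_map V \<alpha> \<epsilon>)"
    and comp: "C \<in> components V (dependency_graph V \<alpha> \<epsilon>)"
    and no_zero: "\<not> connected_to_zero (dependency_graph V \<alpha> \<epsilon>) C"
  shows "fixed_point_system C (monomial_map C \<alpha> \<epsilon>)"
proof -
  let ?F = "monomial_map V \<alpha> \<epsilon>" and ?G = "monomial_map C \<alpha> \<epsilon>" and ?E = "(depends V \<alpha> \<epsilon>)\<^sup>*"
  obtain c where c: "c \<in> V" and C_def: "C = {j. (c, j) \<in> ?E \<and> (j, c) \<in> ?E}"
    using comp by (auto simp: components_eq)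
  have cC: "c \<in> C" and CV: "C \<subseteq> V"
    using c by (auto simp: C_def intro: rtrancl_depends_in)
  \<comment> \<open>\<open>R\<close> collects what \<open>C\<close> reaches outside itself. No
    coefficient vanishes there and \<open>R\<close> is closed under dependency, so the value 1 on
    all of \<open>R\<close> reproduces itself.\<close>
  define R where "R = {j. (c, j) \<in> ?E} - C"
  have RV: "R \<subseteq> V"
    using c by (auto simp: R_def intro: rtrancl_depends_in)
  have R_one: "\<alpha> j = 1" if "j \<in> R" for j
  proof -
    have "j \<in> V" "(c, j) \<in> ?E"
      using that RV by (auto simp: R_def)
    then show ?thesis
      using no_zero cC c unfolding connected_to_zero_iff by (metis bit_not_one_iff)
  qed
  \<comment> \<open>A successor in \<open>C\<close> would lead back to \<open>c\<close> and so put
    \<open>j\<close> itself into \<open>C\<close>.\<close>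
  have R_succ: "k \<in> R" if "j \<in> R" "(j, k) \<in> depends V \<alpha> \<epsilon>" for j k
    using that by (auto simp: R_def C_def intro: rtrancl_into_rtrancl converse_rtrancl_into_rtrancl)
  have C_succ: "k \<in> R" if "j \<in> C" "k \<notin> C" "(j, k) \<in> depends V \<alpha> \<epsilon>" for j k
    using that by (auto simp: R_def C_def intro: rtrancl_into_rtrancl)
  have "?G y = y" if y: "y \<in> cube C" "m > 0" "(?G ^^ m) y = y" for y m
  proof -
    \<comment> \<open>The default 1 makes the factors coming from \<open>R\<close> neutral in the
      monomials of \<open>C\<close>; \<open>inv\<close> shows that this persists.\<close>
    define x where "x = (\<lambda>i\<in>V. if i \<in> C then y i else 1)"
    have inv: "restrict ((?F ^^ k) x) C = (?G ^^ k) y \<and> (\<forall>j\<in>R. (?F ^^ k) x j = 1)" for k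
    proof (induction k)
      case 0
      have "restrict x C = y"
        using y(1) CV unfolding cube_def
        by (intro extensionalityI[of _ C]) (auto simp: x_def PiE_iff)
      then show ?case
        using RV by (intro conjI) (simp, auto simp: x_def R_def)
    next
      case (Suc k)
      have "restrict ((?F ^^ Suc k) x) C = (?G ^^ Suc k) y"
        using restrict_monomial_map[OF data fin CV, of "(?F ^^ k) x"] C_succ Suc by simp
      moreover have "(?F ^^ Suc k) x j = 1" if "j \<in> R" for j
        using monomial_map_eq_1_iff[OF data fin subset_refl, of j "(?F ^^ k) x"]
          that RV R_one R_succ Suc by auto
      ultimately show ?case
        by blast
    qed
    have fin_cube: "finite (cube V :: ('a \<Rightarrow> bit) set)"
    proof -
      have "(UNIV :: bit set) = {0, 1}"
        using bit_not_one_iff by blast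
      then have "finite (UNIV :: bit set)"
        by (metis finite.emptyI finite_insert)
      then show ?thesis
        using fin by (simp add: cube_def finite_PiE)
    qed
    have x: "x \<in> cube V"
      by (simp add: x_def cube_def)
    \<comment> \<open>Iterating \<open>?F ^^ m\<close> instead of \<open>?F\<close> makes the
      preperiod a multiple of \<open>m\<close>, a time at which the restriction to \<open>C\<close>
      is \<open>y\<close> again.\<close>
    obtain p q where q: "q > 0" "((?F ^^ m) ^^ q) (((?F ^^ m) ^^ p) x) = ((?F ^^ m) ^^ p) x"
      using eventually_periodic[OF fin_cube x, of "?F ^^ m"] funpow_monomial_map_in_cube
      by metis
    define z where "z = (?F ^^ (m * p)) x"
    have "(?F ^^ (m * q)) z = z"
      using q(2) by (simp add: z_def funpow_mult)
    moreover have "z \<in> cube V"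
      using x by (simp add: z_def funpow_monomial_map_in_cube)
    ultimately have "?F z = z"
      using fps q(1) y(2) fixed_point_system_iff[of V ?F, OF monomial_map_in_cube]
      by (meson nat_0_less_mult_iff)
    have "((?G ^^ m) ^^ p) y = y"
      using y(3) by (induction p) auto
    then have "(?G ^^ (m * p)) y = y"
      by (simp add: funpow_mult)
    then have "restrict z C = y"
      using inv[of "m * p"] by (simp add: z_def)
    \<comment> \<open>One step further the restriction is \<open>?G y\<close>, while the fixed point
      \<open>z\<close> has not moved.\<close>
    moreover have "restrict (?F z) C = ?G y"
      using inv[of "Suc (m * p)"] \<open>(?G ^^ (m * p)) y = y\<close> by (simp add: z_def)
    ultimately show ?thesis
      using \<open>?F z = z\<close> by simp
  qed
  then show ?thesis
    unfolding fixed_point_system_iff[of C ?G, OF monomial_map_in_cube] by blast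
qed

theorem corollary6p4:
  fixes n :: nat
    and \<alpha> :: "nat \<Rightarrow> bit"
    and \<epsilon> :: "nat \<Rightarrow> nat \<Rightarrow> nat"
    and f :: "(nat \<Rightarrow> bit) \<Rightarrow> (nat \<Rightarrow> bit)"
  assumes "boolean_monomial_system {1..n} \<alpha> \<epsilon> f"
  shows "fixed_point_system {1..n} f \<longleftrightarrow>
    (\<forall>C \<in> components {1..n} (dependency_graph {1..n} \<alpha> \<epsilon>).
       fixed_point_system C (monomial_map C \<alpha> \<epsilon>) \<or>
       connected_to_zero (dependency_graph {1..n} \<alpha> \<epsilon>) C)"
proof -
  have data: "monomial_data {1..n} \<alpha> \<epsilon>"
    and "fixed_point_system {1..n} f \<longleftrightarrow> fixed_point_system {1..n} (monomial_map {1..n} \<alpha> \<epsilon>)"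
    using assms fixed_point_system_cong[of "{1..n}" f]
    by (auto simp: boolean_monomial_system_def)
  then show ?thesis
    using fixed_point_system_if_components[OF data finite_atLeastAtMost]
      fixed_point_system_component[OF data finite_atLeastAtMost] by blast
qed

end
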